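(* Let $A\in\mathbb{R}_{\min}^{n\times n}$ be a min-plus matrix such that all circuits in the associated network $\mathcal{N}(A)$ are separated, i.e. every vertex of $\mathcal{N}(A)$ belongs to at most one circuit. Let $\tilde p_1<\tilde p_2<\cdots<\tilde p_k$ be the distinct average weights of the circuits of $\mathcal{N}(A)$, and for each $i$ let $\tilde C(\tilde\ell_i,\tilde p_i)$ be the homogeneous extended circuit consisting of all circuits of $\mathcal{N}(A)$ whose average weight is $\tilde p_i$, so that $\tilde\ell_i$ is the sum of the lengths of these circuits. Then the characteristic polynomial $g_A(x)=\mathrm{tropdet}(A\oplus x\otimes I)$ can be factorized into linear factors as $$g_A(x)\equiv (x\oplus\tilde p_1)^{\tilde\ell_1}\otimes (x\oplus\tilde p_2)^{\tilde\ell_2}\otimes\cdots\otimes (x\oplus\tilde p_k)^{\tilde\ell_k}\otimes x^r,$$ where $r:=n-(\tilde\ell_1+\tilde\ell_2+\cdots+\tilde\ell_k)$.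
   Context: Min-plus algebra: $\mathbb{R}_{\min}=\mathbb{R}\cup\{+\infty\}$ with $a\oplus b=\min\{a,b\}$, $a\otimes b=a+b$; $\varepsilon=+\infty$ is the identity for $\oplus$ (and absorbing for $\otimes$), $e=0$ is the identity for $\otimes$. Powers are with respect to $\otimes$: $x^m=x\otimes\cdots\otimes x$ ($m$ times) $=mx$, and $x^0=0$; similarly $(x\oplus p)^m=m\min\{x,p\}$. For matrices, $[A\oplus B]_{ij}=a_{ij}\oplus b_{ij}$ and $[\alpha\otimes A]_{ij}=\alpha\otimes a_{ij}$. $I$ is the $n\times n$ matrix with $0$ on the diagonal and $\varepsilon$ elsewhere. Tropical determinant: $\mathrm{tropdet}(A)=\bigoplus_{\sigma\in S_n}a_{1\sigma(1)}\otimes a_{2\sigma(2)}\otimes\cdots\otimes a_{n\sigma(n)}$, where $S_n$ is the symmetric group on $\{1,\dots,n\}$. Min-plus polynomials $p(x)$ are also regarded as (piecewise linear) functions of $x$. $p(x)\equiv p'(x)$ (equivalence) means that $p$ and $p'$ have the same factorization into linear factors, i.e. that they define the same function of $x\in\mathbb{R}_{\min}$, even though their coefficients may differ. Network: for $A=(a_{ij})\in\mathbb{R}_{\min}^{n\times n}$, $\mathcal{N}(A)$ is the directed weighted graph with vertices $v_1,\dots,v_n$ and an edge from $v_i$ to $v_j$ of weight $a_{ij}$ exactly when $a_{ij}\neq\varepsilon$ (loops $i=j$ allowed). A circuit is a closed directed path $(v_{i(0)},v_{i(1)},\dots,v_{i(s)})$, $s\ge 1$, with $i(s)=i(0)$ and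 $i(0),\dots,i(s-1)$ pairwise distinct (a loop is a circuit of length 1); circuits differing only by the choice of starting vertex are the same. Its length is $\ell(C)=s$, its weight sum is $\omega(C)=\sum_{t=0}^{s-1}a_{i(t)i(t+1)}$, and its average weight is $\omega(C)/\ell(C)$. An extended circuit is a set of pairwise vertex-disjoint circuits; its length is the sum of the lengths of its circuits, its weight sum is the sum of their weight sums, and its average weight is weight sum divided by length. $\tilde C(\tilde\ell,\tilde p)$ denotes an extended circuit of length $\tilde\ell$ and average weight $\tilde p$. It is homogeneous if all circuits in it have the same average weight $\tilde p$. *)

theory Defs
  imports
    "Graph_Theory.Arc_Walk"
    "HOL-Computational_Algebra.Polynomial"
    "HOL-Analysis.Finite_Cartesian_Product"
    "HOL-Combinatorics.Permutations"
begin

section \<open>The min-plus semiring\<close>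

text \<open>
  The semiring operations \<open>+\<close>, \<open>*\<close>, \<open>0\<close>, \<open>1\<close> on this type are min-plus addition (minimum),
  min-plus multiplication (ordinary addition), \<open>\<epsilon> = +\<infinity>\<close> and \<open>e = 0\<close>. Hence the generic
  \<open>^\<close>, \<open>\<Sum>\<close>, \<open>\<Prod>\<close>, polynomials and matrices over \<open>minplus\<close> are the min-plus ones.
\<close>

datatype minplus = Fin (the_fin: real) | Infty

instantiation minplus :: comm_semiring_1
begin

definition zero_minplus :: minplus where
  "zero_minplus = Infty"

definition one_minplus :: minplus where
  "one_minplus = Fin 0"

fun plus_minplus :: "minplus \<Rightarrow> minplus \<Rightarrow> minplus" where
  "plus_minplus (Fin a) (Fin b) = Fin (min a b)"
| "plus_minplus Infty y = y"
| "plus_minplus x Infty = x"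

fun times_minplus :: "minplus \<Rightarrow> minplus \<Rightarrow> minplus" where
  "times_minplus (Fin a) (Fin b) = Fin (a + b)"
| "times_minplus Infty y = Infty"
| "times_minplus x Infty = Infty"

instance
proof
  fix a b c :: minplus
  show "a * b * c = a * (b * c)"
    by (cases a; cases b; cases c) auto
  show "a * b = b * a"
    by (cases a; cases b) auto
  show "1 * a = a"
    by (cases a) (auto simp: one_minplus_def)
  show "a + b + c = a + (b + c)"
    by (cases a; cases b; cases c) auto
  show "a + b = b + a"
    by (cases a; cases b) auto
  show "0 + a = a"
    by (cases a) (auto simp: zero_minplus_def)
  show "(a + b) * c = a * c + b * c"
    by (cases a; cases b; cases c) (auto simp: min_add_distrib_left)
  show "0 * a = 0" "a * 0 = 0"
    by (cases a; simp add: zero_minplus_def)+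
  show "(0::minplus) \<noteq> 1"
    by (simp add: zero_minplus_def one_minplus_def)
qed

end

lemma Fin_power: "Fin a ^ m = Fin (real m * a)"
  by (induction m) (auto simp: one_minplus_def algebra_simps)

section \<open>Characteristic polynomial\<close>

text \<open>
  Stated over an arbitrary semiring so that it applies both to min-plus matrices and to
  matrices of min-plus polynomials.
\<close>

definition tropdet :: "'a::comm_semiring_1 ^ 'n ^ 'n \<Rightarrow> 'a" where
  "tropdet A = (\<Sum>\<sigma> | \<sigma> permutes UNIV. \<Prod>i\<in>UNIV. A $ i $ \<sigma> i)"

text \<open>
  \<open>[:0, 1:]\<close> is the indeterminate \<open>x\<close>; \<open>mat c\<close> has \<open>c\<close> on the diagonal and \<open>0 = \<epsilon>\<close> elsewhere,
  so \<open>mat [:0, 1:]\<close> is \<open>x \<otimes> I\<close>.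
\<close>

definition minplus_charpoly :: "minplus ^ 'n ^ 'n \<Rightarrow> minplus poly" where
  "minplus_charpoly A = tropdet (map_matrix (\<lambda>a. [:a:]) A + mat [:0, 1:])"

lemma poly_minplus_charpoly:
  "poly (minplus_charpoly A) x = tropdet (A + mat x)"
proof -
  have "poly ((map_matrix (\<lambda>a. [:a:]) A + mat [:0, 1:]) $ i $ j) x = (A + mat x) $ i $ j" for i j
    by (simp add: mat_def)
  then show ?thesis
    by (simp only: minplus_charpoly_def tropdet_def poly_sum poly_prod)
qed

text \<open>Equality as functions on all of \<open>minplus\<close>, including \<open>x = \<epsilon>\<close>.\<close>

definition minplus_poly_equiv :: "minplus poly \<Rightarrow> minplus poly \<Rightarrow> bool"
    (infix \<open>\<equiv>\<^sub>p\<close> 50) where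
  "f \<equiv>\<^sub>p g \<longleftrightarrow> (\<forall>x. poly f x = poly g x)"

section \<open>Circuits of the network\<close>

definition network :: "minplus ^ 'n ^ 'n \<Rightarrow> ('n, 'n \<times> 'n) pre_digraph" where
  "network A = \<lparr> verts = UNIV, arcs = {(i, j). A $ i $ j \<noteq> 0}, tail = fst, head = snd \<rparr>"

lemma network_simps [simp]:
  "verts (network A) = UNIV" "arcs (network A) = {(i, j). A $ i $ j \<noteq> 0}"
  "tail (network A) = fst" "head (network A) = snd"
  by (simp_all add: network_def)

interpretation network: wf_digraph "network A"
  by unfold_locales simp_all

text \<open>
  Circuits that differ only by the starting vertex are identified by representing a circuit
  as its set of edges; see \<open>circuit_eq_iff_rotate\<close> and \<open>circuit_list\<close> below.
\<close>

definition circuits :: "minplus ^ 'n ^ 'n \<Rightarrow> ('n \<times> 'n) set set" where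
  "circuits A = set ` {c. pre_digraph.cycle (network A) c}"

definition circuit_verts :: "('n \<times> 'n) set \<Rightarrow> 'n set" where
  "circuit_verts C = fst ` C"

definition circuit_length :: "('n \<times> 'n) set \<Rightarrow> nat" where
  "circuit_length C = card C"

definition circuit_weight :: "minplus ^ 'n ^ 'n \<Rightarrow> ('n \<times> 'n) set \<Rightarrow> real" where
  "circuit_weight A C = (\<Sum>(i, j)\<in>C. the_fin (A $ i $ j))"

definition circuit_average :: "minplus ^ 'n ^ 'n \<Rightarrow> ('n \<times> 'n) set \<Rightarrow> real" where
  "circuit_average A C = circuit_weight A C / real (circuit_length C)"

definition circuits_separated :: "minplus ^ 'n ^ 'n \<Rightarrow> bool" where
  "circuits_separated A \<longleftrightarrow>
    (\<forall>v. \<forall>C\<in>circuits A. \<forall>D\<in>circuits A. v \<in> circuit_verts C \<and> v \<in> circuit_verts D \<longrightarrow> C = D)"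

section \<open>Extended circuits\<close>

definition extended_circuit :: "minplus ^ 'n ^ 'n \<Rightarrow> ('n \<times> 'n) set set \<Rightarrow> bool" where
  "extended_circuit A E \<longleftrightarrow>
    E \<subseteq> circuits A \<and> pairwise (\<lambda>C D. disjnt (circuit_verts C) (circuit_verts D)) E"

definition ext_length :: "('n \<times> 'n) set set \<Rightarrow> nat" where
  "ext_length E = (\<Sum>C\<in>E. circuit_length C)"

definition ext_weight :: "minplus ^ 'n ^ 'n \<Rightarrow> ('n \<times> 'n) set set \<Rightarrow> real" where
  "ext_weight A E = (\<Sum>C\<in>E. circuit_weight A C)"

definition ext_average :: "minplus ^ 'n ^ 'n \<Rightarrow> ('n \<times> 'n) set set \<Rightarrow> real" where
  "ext_average A E = ext_weight A E / real (ext_length E)"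

definition homogeneous :: "minplus ^ 'n ^ 'n \<Rightarrow> ('n \<times> 'n) set set \<Rightarrow> bool" where
  "homogeneous A E \<longleftrightarrow> (\<forall>C\<in>E. circuit_average A C = ext_average A E)"

section \<open>Consistency of the encoding\<close>

lemma cycle_step:
  assumes "network.cycle A c" "i < length c"
  shows "fst (c ! (Suc i mod length c)) = snd (c ! i)"
proof -
  from assms(1) obtain u where u: "network.awalk A u c u" and ne: "c \<noteq> []"
    by (auto simp: network.cycle_def)
  then have cas: "network.cas A u c u"
    by (auto simp: network.awalk_def)
  have eq: "map fst c @ [snd (last c)] = fst (hd c) # map snd c"
    using network.awalk_verts_conv[of A u c] network.awalk_verts_conv'[OF cas] ne by simp
  show ?thesis
  proof (cases "Suc i < length c")
    case True
    have "(map fst c @ [snd (last c)]) ! Suc i = (fst (hd c) # map snd c) ! Suc i"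
      by (simp only: eq)
    with True show ?thesis
      by (simp add: nth_append)
  next
    case False
    with assms(2) have i: "Suc i = length c" by simp
    have "fst (hd c) = u"
      using cas ne by (cases c) auto
    moreover have "snd (last c) = u"
      using network.awlast_if_cas[OF cas] ne by (simp add: network.awalk_verts_conv)
    moreover have "length c - 1 = i"
      using i by simp
    ultimately show ?thesis
      using i ne by (simp add: hd_conv_nth last_conv_nth)
  qed
qed

lemma cycle_distinct:
  assumes "network.cycle A c"
  shows "c \<noteq> []" "distinct (map fst c)" "distinct c"
proof -
  from assms obtain u where u: "network.awalk A u c u" and ne: "c \<noteq> []"
      and d: "distinct (tl (network.awalk_verts A u c))"
    by (auto simp: network.cycle_def)
  then have cas: "network.cas A u c u"
    by (auto simp: network.awalk_def)
  have eq: "map fst c @ [snd (last c)] = fst (hd c) # map snd c"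
    using network.awalk_verts_conv[of A u c] network.awalk_verts_conv'[OF cas] ne by simp
  have "snd (last c) = fst (hd c)"
    using cycle_step[OF assms, of "length c - 1"] ne by (simp add: hd_conv_nth last_conv_nth)
  with eq have "mset (map fst c @ [fst (hd c)]) = mset (fst (hd c) # map snd c)"
    by simp
  then have "mset (map fst c) = mset (map snd c)"
    by (simp del: mset_map)
  moreover have "distinct (map snd c)"
    using d network.awalk_verts_conv'[OF cas] ne by simp
  ultimately show "distinct (map fst c)"
    using mset_eq_imp_distinct_iff by blast
  then show "distinct c"
    by (simp add: distinct_map)
  show "c \<noteq> []" by (fact ne)
qed

lemma circuit_list:
  assumes "network.cycle A c"
  shows "circuit_length (set c) = length c"
    and "circuit_weight A (set c) = (\<Sum>(i, j)\<leftarrow>c. the_fin (A $ i $ j))"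
    and "circuit_verts (set c) = set (map fst c)"
    and "card (circuit_verts (set c)) = circuit_length (set c)"
proof -
  note d = cycle_distinct[OF assms]
  show "circuit_length (set c) = length c"
    unfolding circuit_length_def by (rule distinct_card[OF d(3)])
  show "circuit_weight A (set c) = (\<Sum>(i, j)\<leftarrow>c. the_fin (A $ i $ j))"
    unfolding circuit_weight_def by (rule sum.distinct_set_conv_list[OF d(3)])
  show "circuit_verts (set c) = set (map fst c)"
    by (simp add: circuit_verts_def)
  have "inj_on fst (set c)"
    using d(2) by (simp add: distinct_map)
  then show "card (circuit_verts (set c)) = circuit_length (set c)"
    unfolding circuit_length_def circuit_verts_def by (rule card_image)
qed

lemma circuit_eq_iff_rotate:
  assumes "network.cycle A c" "network.cycle A d"
  shows "set c = set d \<longleftrightarrow> (\<exists>m. d = rotate m c)"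
proof
  assume eq: "set c = set d"
  let ?s = "length c"
  note c = cycle_distinct[OF assms(1)] and d = cycle_distinct[OF assms(2)]
  have len: "length d = ?s"
    using c(3) d(3) eq by (metis distinct_card)
  have s: "?s > 0" using c(1) by simp
  have "d ! 0 \<in> set c" using eq s len by simp
  then obtain m where m: "m < ?s" "d ! 0 = c ! m"
    by (metis in_set_conv_nth)
  have "d ! i = c ! ((m + i) mod ?s)" if "i < ?s" for i
    using that
  proof (induction i)
    case 0
    then show ?case using m by simp
  next
    case (Suc i)
    let ?j = "(m + i) mod ?s"
    have "fst (d ! Suc i) = snd (d ! i)"
      using cycle_step[OF assms(2), of i] Suc.prems len by simp
    also have "\<dots> = snd (c ! ?j)"
      using Suc by simp
    also have "\<dots> = fst (c ! (Suc ?j mod ?s))"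
      using cycle_step[OF assms(1), of ?j] s by simp
    also have "Suc ?j mod ?s = (m + Suc i) mod ?s"
      by (simp add: mod_Suc_eq)
    finally have f: "fst (d ! Suc i) = fst (c ! ((m + Suc i) mod ?s))" .
    have "inj_on fst (set c)"
      using c(2) by (simp add: distinct_map)
    moreover have "d ! Suc i \<in> set c"
      unfolding eq using Suc.prems len by simp
    moreover have "c ! ((m + Suc i) mod ?s) \<in> set c"
      using s by simp
    ultimately show ?case
      using f by (simp only: inj_on_eq_iff)
  qed
  then have "d = rotate m c"
    using len by (intro nth_equalityI) (auto simp: nth_rotate)
  then show "\<exists>m. d = rotate m c" ..
qed auto

lemma ext_average_class:
  assumes "circuits_separated A" "q \<in> circuit_average A ` circuits A"
  defines "E \<equiv> {C \<in> circuits A. circuit_average A C = q}"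
  shows "extended_circuit A E" "homogeneous A E" "ext_average A E = q"
proof -
  have fin: "finite E"
    by (rule finite)
  have pos: "circuit_length C > 0" if "C \<in> circuits A" for C
    using that unfolding circuits_def by (auto simp: circuit_list dest: cycle_distinct(1))
  have "ext_weight A E = (\<Sum>C\<in>E. q * real (circuit_length C))"
    unfolding ext_weight_def
  proof (rule sum.cong)
    fix C assume "C \<in> E"
    then show "circuit_weight A C = q * real (circuit_length C)"
      using pos[of C] by (auto simp: E_def circuit_average_def)
  qed simp
  then have "ext_weight A E = q * real (ext_length E)"
    by (simp add: ext_length_def sum_distrib_left)
  moreover have "ext_length E > 0"
  proof -
    obtain C where "C \<in> E" using assms(2) by (auto simp: E_def)
    moreover from this have "circuit_length C > 0" using pos by (auto simp: E_def)
    ultimately show ?thesis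
      unfolding ext_length_def by (intro sum_pos2[OF fin]) simp_all
  qed
  ultimately show avg: "ext_average A E = q"
    by (simp add: ext_average_def)
  then show "homogeneous A E"
    unfolding homogeneous_def by (simp only:) (simp add: E_def)
  show "extended_circuit A E"
    using assms(1)
    unfolding extended_circuit_def circuits_separated_def E_def pairwise_def disjnt_def by blast
qed

text \<open>
  The lengths of the extended circuits of the different average weights add up to at most \<open>n\<close>,
  so the natural-number subtraction in \<open>r = n - (l\<^sub>1 + \<dots> + l\<^sub>k)\<close> never truncates.
\<close>

lemma ext_length_circuits_le:
  assumes "circuits_separated (A :: minplus ^ 'n ^ 'n)"
  shows "ext_length (circuits A) \<le> CARD('n)"
proof -
  have "ext_length (circuits A) = (\<Sum>C\<in>circuits A. card (circuit_verts C))"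
    unfolding ext_length_def
    by (rule sum.cong) (auto simp only: circuits_def circuit_list(4))
  also have "\<dots> = card (\<Union>C\<in>circuits A. circuit_verts C)"
    using assms unfolding circuits_separated_def
    by (intro card_UN_disjoint[symmetric] ballI impI finite) blast
  also have "\<dots> \<le> CARD('n)"
    by (intro card_mono) auto
  finally show ?thesis .
qed

end

theory Submission
  imports Defs "HOL-Combinatorics.Cycles"
begin

text \<open>
  For each value of \<open>x\<close>, the tropical determinant of \<open>A \<oplus> x \<otimes> I\<close> is the least weight of a
  permutation. A permutation of finite weight that moves a vertex follows edges of the network all
  along the orbit of that vertex, so the orbit is a circuit (\<open>permutation_fixes_or_follows\<close>). When
  circuits are separated, this circuit is the only one through its vertices, and hence on each
  circuit \<open>C\<close> the permutation has just two options: to fix all of \<open>C\<close>, at cost \<open>x\<close> per vertex, or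
  to follow \<open>C\<close>, at cost \<open>\<omega>(C)\<close>. Vertices outside all circuits are fixed, at cost \<open>x\<close> each.

  The circuits are disjoint, so these choices are independent (\<open>permutation_of_edges\<close> realises any
  combination of them), and the minimum of the total weight is the sum of the separate minima. The
  contribution of \<open>C\<close> is \<open>x\<^bsup>\<ell>(C)\<^esup> \<oplus> \<omega>(C)\<close>, which equals \<open>(x \<oplus> \<omega>(C)/\<ell>(C))\<^bsup>\<ell>(C)\<^esup>\<close> because
  powers distribute over a minimum (\<open>mp_power_add\<close>). This gives
  \<open>tropdet_shifted_separated\<close>, a product with one factor for each circuit; collecting the circuits of
  equal average weight turns it into the stated factorization.

  A loop at \<open>v\<close> is the one case where fixing and following coincide. There the diagonal entry
  \<open>a\<^sub>v\<^sub>v \<oplus> x\<close> already is the minimum of the two options, and no choice has to be made.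
\<close>

section \<open>The natural order of the min-plus semiring\<close>

text \<open>
  The order induced by \<open>\<oplus>\<close>, that is, the usual order with \<open>\<epsilon> = +\<infinity>\<close> as its largest element.
\<close>

definition mp_le :: "minplus \<Rightarrow> minplus \<Rightarrow> bool"  (infix \<open>\<sqsubseteq>\<close> 50) where
  "a \<sqsubseteq> b \<longleftrightarrow> a + b = a"

lemma mp_le_refl [simp]: "a \<sqsubseteq> a"
  by (cases a) (auto simp: mp_le_def)

lemma mp_le_zero [simp]: "a \<sqsubseteq> 0"
  by (simp add: mp_le_def)

lemma mp_le_add: "a + b \<sqsubseteq> a" "a + b \<sqsubseteq> b"
  by (cases a; cases b; simp add: mp_le_def)+

lemma mp_add_cases: "a + b = a \<or> a + b = (b :: minplus)"
  by (cases a; cases b) (auto simp: min_def)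

lemma mp_le_mult: "a \<sqsubseteq> b \<Longrightarrow> c \<sqsubseteq> d \<Longrightarrow> a * c \<sqsubseteq> b * d"
  by (cases a; cases b; cases c; cases d) (auto simp: mp_le_def min_def split: if_splits)

lemma mp_le_prod: "(\<And>i. i \<in> S \<Longrightarrow> f i \<sqsubseteq> g i) \<Longrightarrow> prod f S \<sqsubseteq> prod g S"
  by (induction S rule: infinite_finite_induct) (auto intro: mp_le_mult)

lemma mp_sum_eq_least:
  assumes "finite S" "a \<in> S" "\<And>b. b \<in> S \<Longrightarrow> f a \<sqsubseteq> f b"
  shows "sum f S = f a"
proof -
  have "f a + sum f T = f a" if "finite T" "T \<subseteq> S" for T
    using that
  proof (induction T rule: finite_induct)
    case (insert b T)
    then have "f a + (f b + sum f T) = f a + sum f T"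
      using assms(3)[of b] by (simp add: mp_le_def add.assoc[symmetric])
    with insert show ?case by simp
  qed simp
  then show ?thesis
    using assms(1,2) by (simp add: sum.remove)
qed

lemma mp_prod_eq_zero_iff: "finite S \<Longrightarrow> prod f S = (0::minplus) \<longleftrightarrow> (\<exists>i\<in>S. f i = 0)"
proof (induction S rule: finite_induct)
  case (insert i S)
  moreover have "a * b = 0 \<longleftrightarrow> a = 0 \<or> b = 0" for a b :: minplus
    by (cases a; cases b) (auto simp: zero_minplus_def)
  ultimately show ?case by simp
qed simp

text \<open>
  The tropical binomial theorem has no mixed terms, since \<open>t \<mapsto> m t\<close> is monotone.
\<close>

lemma mp_power_add: "(a + b) ^ m = a ^ m + (b ^ m :: minplus)"
proof (cases "m = 0")
  case True
  then show ?thesis by (simp add: one_minplus_def)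
next
  case False
  then show ?thesis
    by (cases a; cases b)
      (auto simp: Fin_power min_mult_distrib_left zero_minplus_def[symmetric] zero_power)
qed

lemma prod_Fin: "finite S \<Longrightarrow> (\<Prod>i\<in>S. Fin (f i)) = Fin (sum f S)"
  by (induction S rule: finite_induct) (auto simp: one_minplus_def)

section \<open>Circuits as sets of edges\<close>

lemma circuit_edges:
  assumes "C \<in> circuits A"
  shows "C \<noteq> {}" and "\<And>i j. (i, j) \<in> C \<Longrightarrow> A $ i $ j \<noteq> 0"
    and "inj_on fst C" and "snd ` C = fst ` C" and "inj_on snd C"
proof -
  obtain c where c: "network.cycle A c" and C: "C = set c"
    using assms by (auto simp: circuits_def)
  note d = cycle_distinct[OF c]
  show "C \<noteq> {}" using d(1) C by simp
  show "A $ i $ j \<noteq> 0" if "(i, j) \<in> C" for i j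
    using c that C by (auto simp: network.cycle_def network.awalk_def)
  show inj: "inj_on fst C" using d(2) C by (simp add: distinct_map)
  have pos: "0 < length c" using d(1) by simp
  have "snd ` C \<subseteq> fst ` C"
  proof (rule image_subsetI)
    fix e assume "e \<in> C"
    then obtain i where i: "i < length c" "e = c ! i"
      by (auto simp: C in_set_conv_nth)
    have "c ! (Suc i mod length c) \<in> C"
      using pos by (simp add: C)
    then show "snd e \<in> fst ` C"
      using cycle_step[OF c i(1)] i(2) by (metis imageI)
  qed
  moreover have "fst ` C \<subseteq> snd ` C"
  proof (rule image_subsetI)
    fix e assume "e \<in> C"
    then obtain i where i: "i < length c" "e = c ! i"
      by (auto simp: C in_set_conv_nth)
    \<comment> \<open>the position before \<open>i\<close>, cyclically\<close>
    define j where "j = (if i = 0 then length c - 1 else i - 1)"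
    have j: "j < length c" "Suc j mod length c = i"
      using i pos by (auto simp: j_def)
    then have "c ! j \<in> C"
      by (simp add: C)
    then show "fst e \<in> snd ` C"
      using cycle_step[OF c j(1)] j(2) i(2) by (metis imageI)
  qed
  ultimately show img: "snd ` C = fst ` C" ..
  show "inj_on snd C"
    using img card_image[OF inj] by (intro eq_card_imp_inj_on finite) simp
qed

lemma loop_circuit:
  assumes "A $ v $ v \<noteq> 0"
  shows "{(v, v)} \<in> circuits A"
proof -
  have "network.cycle A [(v, v)]"
    using assms by (auto simp: network.cycle_def network.awalk_def intro!: exI[of _ v])
  then show ?thesis
    unfolding circuits_def by force
qed

text \<open>
  The orbit of \<open>v\<close> under \<open>\<sigma>\<close> lists distinct vertices \<open>v, \<sigma> v, \<sigma>\<^sup>2 v, \<dots>\<close> up to the first return to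
  \<open>v\<close>, so as soon as all its steps are edges it is a circuit.
\<close>

lemma orbit_circuit:
  fixes A :: "minplus ^ 'n ^ 'n"
  assumes perm: "\<sigma> permutes UNIV" and arcs: "\<And>i. A $ ((\<sigma> ^^ i) v) $ (\<sigma> ((\<sigma> ^^ i) v)) \<noteq> 0"
  obtains C where "C \<in> circuits A" "v \<in> circuit_verts C" "\<And>u w. (u, w) \<in> C \<Longrightarrow> \<sigma> u = w"
proof -
  define c where "c = map (\<lambda>u. (u, \<sigma> u)) (support \<sigma> v)"
  have p: "permutation \<sigma>"
    using perm by (auto simp: permutation_permutes)
  have m: "(\<sigma> ^^ least_power \<sigma> v) v = v" "least_power \<sigma> v > 0"
    using least_power_of_permutation[OF p] by auto
  \<comment> \<open>The starting index varies, since removing the first edge of a walk moves its start.\<close>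
  have cas: "network.cas A ((\<sigma> ^^ i) v) (map (\<lambda>u. (u, \<sigma> u)) (map (\<lambda>i. (\<sigma> ^^ i) v) [i..<j])) ((\<sigma> ^^ j) v)"
    if "i \<le> j" for i j
    using that
  proof (induction i rule: inc_induct)
    case (step i)
    then show ?case by (simp add: upt_conv_Cons)
  qed simp
  have "network.cas A v c v"
    using cas[of 0 "least_power \<sigma> v"] m by (simp add: c_def)
  moreover have "set c \<subseteq> arcs (network A)"
    using arcs by (auto simp: c_def)
  ultimately have "network.awalk A v c v"
    by (simp add: network.awalk_def)
  moreover have "distinct (map snd c)"
  proof -
    have "map snd c = map \<sigma> (support \<sigma> v)"
      by (simp add: c_def)
    moreover have "distinct (support \<sigma> v)"
      using cycle_of_permutation[OF p] .
    ultimately show ?thesis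
      using permutes_inj_on[OF perm] by (metis distinct_map)
  qed
  moreover have "c \<noteq> []"
    using m by (simp add: c_def)
  ultimately have "network.cycle A c"
    using network.awalk_verts_conv'[of A v c v]
    by (auto simp: network.cycle_def network.awalk_def)
  then have "set c \<in> circuits A"
    by (auto simp: circuits_def)
  moreover have "v \<in> circuit_verts (set c)"
    using m by (force simp: circuit_verts_def c_def)
  moreover have "\<sigma> u = w" if "(u, w) \<in> set c" for u w
    using that by (auto simp: c_def)
  ultimately show thesis
    using that by blast
qed

text \<open>
  A set of edges that enters and leaves each of its vertices exactly once is the graph of a
  permutation. Applied to a union of disjoint circuits, this gives the permutation that follows these
  circuits and fixes everything else.
\<close>

lemma permutation_of_edges:
  assumes "inj_on fst E" "inj_on snd E" "snd ` E = fst ` E"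
  obtains \<sigma> where "\<sigma> permutes (fst ` E)" "\<And>u w. (u, w) \<in> E \<Longrightarrow> \<sigma> u = w"
proof -
  define \<sigma> where "\<sigma> v = (if v \<in> fst ` E then snd (inv_into E fst v) else v)" for v
  have eq: "\<sigma> (fst e) = snd e" if "e \<in> E" for e
    using that assms(1) by (simp add: \<sigma>_def)
  have "bij_betw \<sigma> (fst ` E) (fst ` E)"
    unfolding bij_betw_def
  proof
    show "inj_on \<sigma> (fst ` E)"
    proof (rule inj_onI)
      fix v w assume vw: "v \<in> fst ` E" "w \<in> fst ` E" "\<sigma> v = \<sigma> w"
      then obtain e f where ef: "e \<in> E" "f \<in> E" "v = fst e" "w = fst f"
        by blast
      then have "snd e = snd f"
        using vw(3) eq by simp
      then show "v = w"
        using inj_onD[OF assms(2)] ef by blast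
    qed
    show "\<sigma> ` fst ` E = fst ` E"
      using eq assms(3) by (simp add: image_image)
  qed
  then have "\<sigma> permutes (fst ` E)"
    by (rule bij_imp_permutes) (simp add: \<sigma>_def)
  moreover have "\<sigma> u = w" if "(u, w) \<in> E" for u w
    using eq[OF that] by simp
  ultimately show thesis
    using that by blast
qed

section \<open>Separated circuits\<close>

lemma separated_unique:
  assumes "circuits_separated A" "C \<in> circuits A" "D \<in> circuits A"
    "v \<in> circuit_verts C" "v \<in> circuit_verts D"
  shows "C = D"
  using assms unfolding circuits_separated_def by blast

lemma separated_disjoint:
  assumes "circuits_separated A"
  shows "\<forall>C\<in>circuits A. \<forall>D\<in>circuits A. C \<noteq> D \<longrightarrow> circuit_verts C \<inter> circuit_verts D = {}"
  using assms unfolding circuits_separated_def by blast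

text \<open>
  A finite diagonal entry is itself a circuit, so in a separated network a vertex on a circuit of
  length at least two has diagonal entry \<open>\<epsilon>\<close>: fixing it costs exactly \<open>x\<close>.
\<close>

lemma separated_loop:
  assumes "circuits_separated A" "C \<in> circuits A" "v \<in> circuit_verts C" "A $ v $ v \<noteq> 0"
  shows "C = {(v, v)}"
  using assms loop_circuit[OF assms(4)]
  by (intro separated_unique[OF assms(1,2)]) (auto simp: circuit_verts_def)

lemma shifted_entry:
  "(A + mat x) $ i $ j = (if i = j then A $ i $ i + x else A $ i $ j :: minplus)"
  by (simp add: mat_def)

lemma circuit_product:
  assumes "C \<in> circuits A" "\<And>u w. (u, w) \<in> C \<Longrightarrow> \<sigma> u = w"
  shows "(\<Prod>u\<in>circuit_verts C. A $ u $ \<sigma> u) = Fin (circuit_weight A C)"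
proof -
  have "(\<Prod>u\<in>circuit_verts C. A $ u $ \<sigma> u) = (\<Prod>e\<in>C. A $ fst e $ snd e)"
    unfolding circuit_verts_def using assms(2)
    by (subst prod.reindex[OF circuit_edges(3)[OF assms(1)]]) (auto intro!: prod.cong)
  also have "\<dots> = (\<Prod>e\<in>C. Fin (the_fin (A $ fst e $ snd e)))"
  proof (rule prod.cong)
    fix e assume "e \<in> C"
    then have "A $ fst e $ snd e \<noteq> 0"
      using circuit_edges(2)[OF assms(1), of "fst e" "snd e"] by simp
    then show "A $ fst e $ snd e = Fin (the_fin (A $ fst e $ snd e))"
      by (cases "A $ fst e $ snd e") (auto simp: zero_minplus_def)
  qed simp
  also have "\<dots> = Fin (circuit_weight A C)"
    by (simp add: prod_Fin circuit_weight_def case_prod_unfold)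
  finally show ?thesis .
qed

lemma card_circuit_verts: "C \<in> circuits A \<Longrightarrow> card (circuit_verts C) = circuit_length C"
  by (auto simp: circuits_def circuit_list(4))

definition circuit_factor :: "minplus ^ 'n ^ 'n \<Rightarrow> minplus \<Rightarrow> ('n \<times> 'n) set \<Rightarrow> minplus" where
  "circuit_factor A x C = (Fin (circuit_average A C) + x) ^ circuit_length C"

lemma circuit_factor_eq:
  assumes "C \<in> circuits A"
  shows "circuit_factor A x C = Fin (circuit_weight A C) + x ^ circuit_length C"
proof -
  have "circuit_length C > 0"
    using circuit_edges(1)[OF assms] by (simp add: circuit_length_def card_gt_0_iff)
  then show ?thesis
    by (simp add: circuit_factor_def mp_power_add Fin_power circuit_average_def)
qed

lemma shifted_product_loop:
  assumes "{(v, v)} \<in> circuits A" "\<sigma> v = v"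
  shows "(\<Prod>u\<in>circuit_verts {(v, v)}. (A + mat x) $ u $ \<sigma> u) = circuit_factor A x {(v, v)}"
  using circuit_product[OF assms(1), of \<sigma>] assms(2) shifted_entry[of A x v v]
  unfolding circuit_factor_eq[OF assms(1)]
  by (simp add: circuit_verts_def circuit_length_def)

text \<open>
  The two options on a circuit. The alternative \<open>circuit_factor A x C\<close> in both conclusions is the
  case of a loop, where the options coincide.
\<close>

lemma shifted_product_along:
  assumes "circuits_separated A" "C \<in> circuits A" "\<And>u w. (u, w) \<in> C \<Longrightarrow> \<sigma> u = w"
  shows "(\<Prod>u\<in>circuit_verts C. (A + mat x) $ u $ \<sigma> u) \<in>
    {circuit_factor A x C, Fin (circuit_weight A C)}"
proof (cases "\<exists>v. C = {(v, v)}")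
  case True
  then obtain v where C: "C = {(v, v)}" ..
  then show ?thesis
    using shifted_product_loop[of v A \<sigma> x] assms(2,3) by simp
next
  case False
  have "(A + mat x) $ u $ \<sigma> u = A $ u $ \<sigma> u" if "u \<in> circuit_verts C" for u
  proof -
    have e: "(u, \<sigma> u) \<in> C"
      using that assms(3) by (force simp: circuit_verts_def)
    have "u \<noteq> \<sigma> u"
      using circuit_edges(2)[OF assms(2) e] separated_loop[OF assms(1,2) that] False by auto
    then show ?thesis by (simp only: shifted_entry if_False)
  qed
  then show ?thesis
    using circuit_product[OF assms(2,3)] by simp
qed

lemma shifted_product_fixed:
  assumes "circuits_separated A" "C \<in> circuits A" "\<And>u. u \<in> circuit_verts C \<Longrightarrow> \<sigma> u = u"
  shows "(\<Prod>u\<in>circuit_verts C. (A + mat x) $ u $ \<sigma> u) \<in>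
    {circuit_factor A x C, x ^ circuit_length C}"
proof (cases "\<exists>v. C = {(v, v)}")
  case True
  then obtain v where C: "C = {(v, v)}" ..
  then have "\<sigma> v = v"
    using assms(3) by (simp add: circuit_verts_def)
  then show ?thesis
    using shifted_product_loop[of v A \<sigma> x] assms(2) unfolding C by simp
next
  case False
  have "(A + mat x) $ u $ \<sigma> u = x" if "u \<in> circuit_verts C" for u
    using separated_loop[OF assms(1,2) that] False assms(3)[OF that]
    by (metis add_0 shifted_entry)
  then show ?thesis
    using card_circuit_verts[OF assms(2)] by simp
qed

lemma prod_over_circuits:
  fixes A :: "minplus ^ 'n ^ 'n"
  assumes "circuits_separated A"
  shows "prod f UNIV =
    (\<Prod>C\<in>circuits A. prod f (circuit_verts C)) * prod f (- (\<Union>C\<in>circuits A. circuit_verts C))"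
proof -
  let ?V = "\<Union>C\<in>circuits A. circuit_verts C"
  have "prod f UNIV = prod f ?V * prod f (- ?V)"
    using prod.union_disjoint[of ?V "- ?V" f] by (simp only: Compl_partition finite Compl_disjoint)
  also have "prod f ?V = (\<Prod>C\<in>circuits A. prod f (circuit_verts C))"
    using separated_disjoint[OF assms] by (intro prod.UNION_disjoint ballI finite) blast+
  finally show ?thesis .
qed

text \<open>
  The diagonal shift only changes the cost of fixed vertices. The vertices in the orbit of a moved
  vertex are all moved, so there finiteness of the shifted entries means that the steps are edges.
\<close>

lemma permutation_fixes_or_follows:
  fixes A :: "minplus ^ 'n ^ 'n"
  assumes perm: "\<sigma> permutes UNIV" and nz: "\<And>v. (A + mat x) $ v $ \<sigma> v \<noteq> 0"
  obtains "\<sigma> v = v" | C where "C \<in> circuits A" "v \<in> circuit_verts C" "\<And>u w. (u, w) \<in> C \<Longrightarrow> \<sigma> u = w"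
proof (cases "\<sigma> v = v")
  case False
  have "\<sigma> ((\<sigma> ^^ i) v) \<noteq> (\<sigma> ^^ i) v" for i
    using False permutes_inj[OF perm] by (induction i) (auto dest: injD)
  then have "A $ ((\<sigma> ^^ i) v) $ (\<sigma> ((\<sigma> ^^ i) v)) \<noteq> 0" for i
    using nz[of "(\<sigma> ^^ i) v"] by (metis shifted_entry)
  from orbit_circuit[OF perm this] that(2) show thesis
    by metis
qed

text \<open>
  No permutation beats the product, as on each circuit its weight is one of the two values whose
  minimum is the factor of that circuit, or, on a loop, that minimum itself. Equality is attained by following exactly the circuits \<open>C\<close>
  with \<open>\<omega>(C) \<le> x\<^bsup>\<ell>(C)\<^esup>\<close>.
\<close>

lemma tropdet_shifted_separated:
  fixes A :: "minplus ^ 'n ^ 'n"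
  assumes sep: "circuits_separated A"
  shows "tropdet (A + mat x) =
    (\<Prod>C\<in>circuits A. circuit_factor A x C) * x ^ card (- (\<Union>C\<in>circuits A. circuit_verts C))"
    (is "_ = ?F * x ^ card ?R")
proof -
  let ?t = "\<lambda>\<sigma>. \<Prod>v\<in>UNIV. (A + mat x) $ v $ \<sigma> v"
  have off: "(A + mat x) $ v $ \<sigma> v = x" if "v \<in> ?R" "\<sigma> v = v" for \<sigma> v
  proof -
    have "A $ v $ v = 0"
      using that(1) loop_circuit[of A v] by (force simp: circuit_verts_def)
    then show ?thesis
      using that(2) shifted_entry[of A x v v] by simp
  qed
  have lower: "?F * x ^ card ?R \<sqsubseteq> ?t \<sigma>" if perm: "\<sigma> permutes UNIV" for \<sigma>
  proof (cases "?t \<sigma> = 0")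
    case False
    then have nz: "(A + mat x) $ v $ \<sigma> v \<noteq> 0" for v
      by (auto simp: mp_prod_eq_zero_iff)
    note orb = permutation_fixes_or_follows[OF perm nz]
    have "circuit_factor A x C \<sqsubseteq> (\<Prod>v\<in>circuit_verts C. (A + mat x) $ v $ \<sigma> v)"
      if C: "C \<in> circuits A" for C
    proof (cases "\<forall>v\<in>circuit_verts C. \<sigma> v = v")
      case True
      then show ?thesis
        using shifted_product_fixed[OF sep C, of \<sigma> x] mp_le_add circuit_factor_eq[OF C, of x] by auto
    next
      case False
      then obtain v where v: "v \<in> circuit_verts C" "\<sigma> v \<noteq> v" by blast
      then obtain D where "D \<in> circuits A" "v \<in> circuit_verts D" "\<And>u w. (u, w) \<in> D \<Longrightarrow> \<sigma> u = w"
        using orb by metis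
      with separated_unique[OF sep C _ v(1)] have "\<And>u w. (u, w) \<in> C \<Longrightarrow> \<sigma> u = w" by blast
      then show ?thesis
        using shifted_product_along[OF sep C, of \<sigma> x] mp_le_add circuit_factor_eq[OF C, of x] by auto
    qed
    moreover have "(\<Prod>v\<in>?R. (A + mat x) $ v $ \<sigma> v) = x ^ card ?R"
    proof -
      have "\<sigma> v = v" if "v \<in> ?R" for v
        by (rule orb[of v]) (use that in auto)
      then show ?thesis using off by simp
    qed
    ultimately show ?thesis
      unfolding prod_over_circuits[OF sep] by (auto intro!: mp_le_mult mp_le_prod)
  qed simp
  have "\<exists>\<sigma>. \<sigma> permutes UNIV \<and> ?t \<sigma> = ?F * x ^ card ?R"
  proof -
    define T where "T = {C \<in> circuits A. circuit_factor A x C = Fin (circuit_weight A C)}"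
    have T: "C \<in> circuits A" if "C \<in> T" for C
      using that by (simp add: T_def)
    have same: "C = D" if "C \<in> T" "D \<in> T" "e \<in> C" "f \<in> D" "fst e = fst f \<or> snd e = snd f" for C D e f
    proof -
      have "fst ` C \<inter> fst ` D \<noteq> {}"
        using that(3-5) circuit_edges(4)[OF T[OF that(1)]] circuit_edges(4)[OF T[OF that(2)]] by blast
      then show ?thesis
        using separated_unique[OF sep T[OF that(1)] T[OF that(2)]] by (auto simp: circuit_verts_def)
    qed
    have "inj_on fst (\<Union>T)"
    proof (rule inj_onI)
      fix e f assume ef: "e \<in> \<Union>T" "f \<in> \<Union>T" "fst e = fst f"
      then obtain C where "C \<in> T" "e \<in> C" "f \<in> C" using same by blast
      with ef(3) show "e = f" using inj_onD[OF circuit_edges(3)[OF T]] by blast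
    qed
    moreover have "inj_on snd (\<Union>T)"
    proof (rule inj_onI)
      fix e f assume ef: "e \<in> \<Union>T" "f \<in> \<Union>T" "snd e = snd f"
      then obtain C where "C \<in> T" "e \<in> C" "f \<in> C" using same by blast
      with ef(3) show "e = f" using inj_onD[OF circuit_edges(5)[OF T]] by blast
    qed
    moreover have "snd ` \<Union>T = fst ` \<Union>T"
      using circuit_edges(4)[OF T] by (simp add: image_Union)
    ultimately obtain \<sigma> where \<sigma>: "\<sigma> permutes (fst ` \<Union>T)" "\<And>u w. (u, w) \<in> \<Union>T \<Longrightarrow> \<sigma> u = w"
      by (rule permutation_of_edges) blast
    have "(\<Prod>v\<in>circuit_verts C. (A + mat x) $ v $ \<sigma> v) = circuit_factor A x C"
      if C: "C \<in> circuits A" for C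
    proof (cases "C \<in> T")
      case True
      then have "\<And>u w. (u, w) \<in> C \<Longrightarrow> \<sigma> u = w" using \<sigma>(2) by blast
      then show ?thesis
        using shifted_product_along[OF sep C, of \<sigma> x] True by (auto simp: T_def)
    next
      case False
      then have "circuit_factor A x C = x ^ circuit_length C"
        using mp_add_cases C by (auto simp: T_def circuit_factor_eq)
      moreover have "\<sigma> u = u" if u: "u \<in> circuit_verts C" for u
      proof -
        have "u \<notin> fst ` \<Union>T"
          using separated_unique[OF sep C T u] False by (force simp: circuit_verts_def)
        then show ?thesis using \<sigma>(1) by (simp add: permutes_not_in)
      qed
      ultimately show ?thesis
        using shifted_product_fixed[OF sep C, of \<sigma> x] by auto
    qed
    moreover have "\<sigma> v = v" if "v \<in> ?R" for v
    proof -
      have "v \<notin> fst ` \<Union>T"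
        using that T by (force simp: circuit_verts_def)
      then show ?thesis using \<sigma>(1) by (simp add: permutes_not_in)
    qed
    ultimately have "?t \<sigma> = ?F * x ^ card ?R"
      unfolding prod_over_circuits[OF sep] using off by simp
    then show ?thesis
      using permutes_subset[OF \<sigma>(1)] by blast
  qed
  then obtain \<sigma> where "\<sigma> permutes UNIV" "?t \<sigma> = ?F * x ^ card ?R" by blast
  then show ?thesis
    unfolding tropdet_def using lower
    by (subst mp_sum_eq_least[of _ \<sigma>]) (auto intro: finite)
qed

section \<open>Collecting circuits of equal average weight\<close>

theorem theorem5p3:
  fixes A :: "minplus ^ 'n ^ 'n"
    and k :: nat and p :: "nat \<Rightarrow> real"
    and E :: "nat \<Rightarrow> ('n \<times> 'n) set set" and l :: "nat \<Rightarrow> nat" and r :: nat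
  assumes "circuits_separated A"
    and "strict_mono_on {1..k} p"
    and "p ` {1..k} = circuit_average A ` circuits A"
    and "\<And>i. i \<in> {1..k} \<Longrightarrow> E i = {C \<in> circuits A. circuit_average A C = p i}"
    and "\<And>i. i \<in> {1..k} \<Longrightarrow> l i = ext_length (E i)"
    and "r = CARD('n) - (\<Sum>i=1..k. l i)"
  shows "minplus_charpoly A \<equiv>\<^sub>p (\<Prod>i=1..k. [:Fin (p i), 1:] ^ l i) * [:0, 1:] ^ r"
proof -
  let ?V = "\<Union>C\<in>circuits A. circuit_verts C"
  have inj: "inj_on p {1..k}"
    using assms(2) by (rule strict_mono_on_imp_inj_on)
  have cover: "(\<Union>i\<in>{1..k}. E i) = circuits A"
    using assms(3,4) by (auto simp: set_eq_iff image_iff)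
  have disj: "\<forall>i\<in>{1..k}. \<forall>j\<in>{1..k}. i \<noteq> j \<longrightarrow> E i \<inter> E j = {}"
  proof (intro ballI impI)
    fix i j assume ij: "i \<in> {1..k}" "j \<in> {1..k}" "i \<noteq> j"
    then have "p i \<noteq> p j"
      using inj by (meson inj_onD)
    then show "E i \<inter> E j = {}"
      using assms(4) ij by auto
  qed
  have "(\<Sum>i=1..k. l i) = (\<Sum>i=1..k. \<Sum>C\<in>E i. circuit_length C)"
    using assms(5) by (simp add: ext_length_def)
  also have "\<dots> = (\<Sum>C\<in>circuits A. circuit_length C)"
    unfolding cover[symmetric] using disj by (intro sum.UNION_disjoint[symmetric]) auto
  also have "\<dots> = (\<Sum>C\<in>circuits A. card (circuit_verts C))"
    by (simp add: card_circuit_verts)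
  also have "\<dots> = card ?V"
    using separated_disjoint[OF assms(1)]
    by (intro card_UN_disjoint[symmetric] ballI finite) blast+
  finally have r: "r = card (- ?V)"
    using assms(6) by (simp only: Compl_eq_Diff_UNIV card_Diff_subset finite subset_UNIV)
  have "poly (minplus_charpoly A) x = poly ((\<Prod>i=1..k. [:Fin (p i), 1:] ^ l i) * [:0, 1:] ^ r) x" for x
  proof -
    have "(Fin (p i) + x) ^ l i = (\<Prod>C\<in>E i. circuit_factor A x C)" if "i \<in> {1..k}" for i
    proof -
      have "(Fin (p i) + x) ^ l i = (\<Prod>C\<in>E i. (Fin (p i) + x) ^ circuit_length C)"
        using assms(5)[OF that] by (simp add: ext_length_def power_sum)
      also have "\<dots> = (\<Prod>C\<in>E i. circuit_factor A x C)"
        using assms(4)[OF that] by (intro prod.cong) (auto simp: circuit_factor_def)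
      finally show ?thesis .
    qed
    then have "(\<Prod>i=1..k. (Fin (p i) + x) ^ l i) = (\<Prod>i=1..k. \<Prod>C\<in>E i. circuit_factor A x C)"
      by simp
    also have "\<dots> = (\<Prod>C\<in>circuits A. circuit_factor A x C)"
      unfolding cover[symmetric] using disj by (intro prod.UNION_disjoint[symmetric]) auto
    finally show ?thesis
      unfolding poly_minplus_charpoly tropdet_shifted_separated[OF assms(1)]
      by (simp add: poly_prod r)
  qed
  then show ?thesis
    by (simp add: minplus_poly_equiv_def)
qed

end
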